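(* Let $k \geq 3$. Then $$g_1(k, k-2) \leq \left\lceil \frac{k^2}{4} \right\rceil = \begin{cases} \frac{1}{4}(k^2+3), & k \text{ odd},\\ \frac{1}{4}k^2, & k \text{ even};\end{cases}$$ that is, every finite $k$-uniform hypergraph $H$ with $\nu^{(k-2)}(H) = 1$ satisfies $\tau^{(k-2)}(H) \leq \lceil k^2/4 \rceil$.
   Context: For a $k$-uniform hypergraph $H$ with vertex set $V$ and $1 \le m \le k-1$: an $m$-matching of $H$ is a set $M$ of edges with $|e \cap e'| < m$ for all distinct $e, e' \in M$; $\nu^{(m)}(H)$ is the maximum size of an $m$-matching. An $m$-cover is a set $C \subseteq \binom{V}{m}$ such that every edge of $H$ contains some member of $C$; $\tau^{(m)}(H)$ is the minimum size of an $m$-cover. $g_1(k,m)$ is the supremum of $\tau^{(m)}(H)/\nu^{(m)}(H)$ over all finite $k$-uniform hypergraphs $H$ with $\nu^{(m)}(H) = 1$. *)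

theory Defs
  imports Complex_Main "HOL-Library.Ramsey" "HOL-Library.Extended_Real"
begin

text \<open>A hypergraph is given by its vertex set \<open>V\<close> and its edge set \<open>E\<close>;
  \<open>nsets V k\<close> is the set of all \<open>k\<close>-element subsets of \<open>V\<close>.\<close>

definition uniform_hypergraph :: "nat \<Rightarrow> 'a set \<Rightarrow> 'a set set \<Rightarrow> bool" where
  "uniform_hypergraph k V E \<longleftrightarrow> finite V \<and> E \<subseteq> nsets V k"

definition m_matching :: "nat \<Rightarrow> 'a set set \<Rightarrow> 'a set set \<Rightarrow> bool" where
  "m_matching m E M \<longleftrightarrow> M \<subseteq> E \<and> (\<forall>e\<in>M. \<forall>e'\<in>M. e \<noteq> e' \<longrightarrow> card (e \<inter> e') < m)"

definition m_cover :: "nat \<Rightarrow> 'a set \<Rightarrow> 'a set set \<Rightarrow> 'a set set \<Rightarrow> bool" where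
  "m_cover m V E C \<longleftrightarrow> C \<subseteq> nsets V m \<and> (\<forall>e\<in>E. \<exists>c\<in>C. c \<subseteq> e)"

text \<open>For a finite \<open>k\<close>-uniform hypergraph and \<open>m \<le> k\<close>, the maximum and the minimum below
  range over finite nonempty sets: \<open>{}\<close> is a matching and \<open>nsets V m\<close> is a cover.\<close>

definition matching_number :: "nat \<Rightarrow> 'a set set \<Rightarrow> nat" where
  "matching_number m E = Max (card ` {M. m_matching m E M})"

definition cover_number :: "nat \<Rightarrow> 'a set \<Rightarrow> 'a set set \<Rightarrow> nat" where
  "cover_number m V E = Min (card ` {C. m_cover m V E C})"

text \<open>The supremum is taken in the extended reals, so that it is meaningful without
  knowing in advance that the ratios are bounded. Vertices are natural numbers: every
  finite hypergraph is isomorphic to one of these.\<close>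

definition g1 :: "nat \<Rightarrow> nat \<Rightarrow> ereal" where
  "g1 k m = Sup {ereal (real (cover_number m V E) / real (matching_number m E)) | V E.
     uniform_hypergraph k (V :: nat set) E \<and> matching_number m E = 1}"

end

theory Submission
  imports Defs
begin

text \<open>Fix an edge \<open>e\<close>. Every other edge misses at most two vertices of \<open>e\<close>; let \<open>G\<close> be the graph
  on \<open>e\<close> formed by the missing pairs \<open>e - f\<close>. The complements in \<open>e\<close> of the pairs of any
  graph that contains \<open>G\<close> and has no isolated vertex form a cover, so by Mantel's theorem
  \<open>k\<^sup>2/4\<close> sets suffice if \<open>G\<close> is triangle-free. Edges with disjoint missing pairs
  have the same two vertices outside \<open>e\<close>. Hence, if \<open>G\<close> contains a triangle, it has a vertex cover
  of size 2, or it lives on 4 vertices, or all \<open>f - e\<close> with \<open>|e - f| = 2\<close> coincide. The first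
  two kinds of graphs have few pairs once \<open>k \<ge> 5\<close>, and in the third case
  the whole family lives on \<open>k + 2\<close> points. For \<open>k = 4\<close> the three perfect matchings of \<open>e\<close> are
  considered instead: if two of them lie in \<open>G\<close>, the associated outside pairs
  together with the third matching form a cover.\<close>

section \<open>Pairs of vertices and the arithmetic of the bound\<close>

lemma nsets_2_memI: "a \<in> A \<Longrightarrow> b \<in> A \<Longrightarrow> a \<noteq> b \<Longrightarrow> {a, b} \<in> nsets A 2"
  by (auto simp: nsets_def)

lemma nsets_2_memE:
  assumes "p \<in> nsets A 2"
  obtains a b where "p = {a, b}" "a \<noteq> b" "a \<in> A" "b \<in> A"
  using assms by (auto simp: nsets_def card_2_iff)

text \<open>On natural numbers, rounding up \<open>n / 4\<close> is \<open>(n + 3) div 4\<close>; in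
  this form the bound is compared with cardinalities.\<close>

lemma ceiling_quarter_square: "\<lceil>real k ^ 2 / 4\<rceil> = int ((k ^ 2 + 3) div 4)"
proof (rule ceiling_unique)
  have "k ^ 2 < 4 * ((k ^ 2 + 3) div 4) + 1" "4 * ((k ^ 2 + 3) div 4) < k ^ 2 + 4"
    by linarith+
  then have "real (k ^ 2) < real (4 * ((k ^ 2 + 3) div 4) + 1)"
    "real (4 * ((k ^ 2 + 3) div 4)) < real (k ^ 2 + 4)"
    using of_nat_less_iff by blast+
  moreover have "k ^ 2 \<le> 4 * ((k ^ 2 + 3) div 4)" by linarith
  then have "real (k ^ 2) \<le> real (4 * ((k ^ 2 + 3) div 4))"
    using of_nat_le_iff by blast
  ultimately show "real_of_int (int ((k ^ 2 + 3) div 4)) - 1 < real k ^ 2 / 4"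
    "real k ^ 2 / 4 \<le> real_of_int (int ((k ^ 2 + 3) div 4))"
    by simp_all
qed

lemma ceiling_quarter_square_cases:
  "real_of_int \<lceil>real k ^ 2 / 4\<rceil> = (if odd k then 1 / 4 * (real k ^ 2 + 3) else 1 / 4 * real k ^ 2)"
proof (cases "odd k")
  case True
  then obtain j where j: "k = 2 * j + 1" by (elim oddE)
  have "k ^ 2 + 3 = 4 * (j ^ 2 + j + 1)" by (simp add: j power2_eq_square)
  then have "(k ^ 2 + 3) div 4 = j ^ 2 + j + 1" by simp
  then show ?thesis
    using True unfolding ceiling_quarter_square by (simp add: j power2_eq_square field_simps)
next
  case False
  then obtain j where j: "k = 2 * j" by (auto elim: evenE)
  have "(k ^ 2 + 3) div 4 = j ^ 2" by (simp add: j power2_eq_square)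
  then show ?thesis
    using False unfolding ceiling_quarter_square by (simp add: j power2_eq_square)
qed

lemma Union_nsets_2:
  assumes "card A \<ge> 2"
  shows "\<Union>(nsets A 2) = A"
proof
  show "A \<subseteq> \<Union>(nsets A 2)"
  proof
    fix x assume x: "x \<in> A"
    have "A \<noteq> {x}" using assms by auto
    then obtain y where "y \<in> A" "y \<noteq> x" using x by blast
    then show "x \<in> \<Union>(nsets A 2)" using x by (intro UnionI[of "{x, y}"]) (auto intro: nsets_2_memI)
  qed
qed (auto simp: nsets_def)

subsection \<open>Triangle-free graphs\<close>

text \<open>If two of \<open>a\<close>, \<open>b\<close>, \<open>c\<close> coincide, one of the
  three sets is a singleton; so for a set of 2-element sets this is the usual notion.\<close>

definition triangle_free :: "'a set set \<Rightarrow> bool" where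
  "triangle_free P \<longleftrightarrow> (\<forall>a b c. {a, b} \<in> P \<longrightarrow> {a, c} \<in> P \<longrightarrow> {b, c} \<notin> P)"

text \<open>Delete the ends of an edge \<open>{u, v}\<close>. Each of the other n - 2 vertices is
  joined to at most one of them, so at most n - 1 edges disappear, and n^2 - (n - 2)^2 = 4 (n -
  1).\<close>

theorem mantel:
  assumes "finite A" "P \<subseteq> nsets A 2" "triangle_free P"
  shows "4 * card P \<le> (card A) ^ 2"
  using assms
proof (induction "card A" arbitrary: A P rule: less_induct)
  case less
  show ?case
  proof (cases "P = {}")
    case False
    then obtain u v where uv: "{u, v} \<in> P" "u \<noteq> v" "u \<in> A" "v \<in> A"
      using less.prems(2) by (metis all_not_in_conv nsets_2_memE subsetD)
    define B where "B = A - {u, v}"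
    define P1 where "P1 = P \<inter> nsets B 2"
    \<comment> \<open>\<open>h w\<close> is the only possible edge from \<open>w\<close> to
      \<open>{u, v}\<close>; if there is none, the default \<open>{v, w}\<close> does no harm to an
      upper bound.\<close>
    define h where "h = (\<lambda>w. if {u, w} \<in> P then {u, w} else {v, w})"
    have cB: "card A = card B + 2" "finite B"
      using uv less.prems(1) card_Diff_subset[of "{u,v}" A] card_mono[of A "{u,v}"]
      by (auto simp: B_def)
    have "4 * card P1 \<le> (card B) ^ 2"
      using less.hyps[of B P1] cB less.prems(3) by (auto simp: P1_def triangle_free_def)
    have "P \<subseteq> insert {u, v} (P1 \<union> h ` B)"
    proof
      fix p assume p: "p \<in> P"
      then obtain a b where ab: "p = {a, b}" "a \<noteq> b" "a \<in> A" "b \<in> A"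
        using less.prems(2) by (meson nsets_2_memE subsetD)
      have excl: "{v, w} \<in> P \<Longrightarrow> {u, w} \<notin> P" for w
        using less.prems(3) uv(1) unfolding triangle_free_def by blast
      have hw: "p \<in> h ` B" if "w \<in> B" "p = {u, w} \<or> p = {v, w}" for w
      proof -
        have "p = h w" using that(2) p excl[of w] unfolding h_def by presburger
        then show ?thesis using that(1) by blast
      qed
      consider "a \<in> B" "b \<in> B" | "a \<notin> B" "b \<notin> B" | "a \<in> B" "b \<notin> B" | "a \<notin> B" "b \<in> B"
        by blast
      then show "p \<in> insert {u, v} (P1 \<union> h ` B)"
      proof cases
        case 1 then show ?thesis using p ab by (auto simp: P1_def intro: nsets_2_memI)
      next
        case 2 then show ?thesis using ab by (auto simp: B_def)
      next
        case 3 then show ?thesis using ab hw[of a] by (auto simp: B_def insert_commute)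
      next
        case 4 then show ?thesis using ab hw[of b] by (auto simp: B_def insert_commute)
      qed
    qed
    moreover have fin: "finite P1" using cB by (simp add: P1_def finite_imp_finite_nsets)
    ultimately have "card P \<le> card (insert {u, v} (P1 \<union> h ` B))"
      using cB by (intro card_mono) auto
    also have "\<dots> \<le> Suc (card (P1 \<union> h ` B))" by (rule card_insert_le_m1) auto
    also have "\<dots> \<le> Suc (card P1 + card B)"
      using card_Un_le[of P1 "h ` B"] card_image_le[OF cB(2), of h] by linarith
    finally show ?thesis
      using \<open>4 * card P1 \<le> (card B) ^ 2\<close> by (simp add: cB power2_eq_square)
  qed simp
qed

lemma triangle_free_extend_covering:
  assumes "finite A" "P \<subseteq> nsets A 2" "triangle_free P" "card A \<ge> 2"
  obtains Q where "P \<subseteq> Q" "Q \<subseteq> nsets A 2" "\<Union>Q = A" "4 * card Q \<le> (card A) ^ 2"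
proof -
  \<comment> \<open>A maximal triangle-free graph has no isolated vertex: a pendant edge creates no triangle.\<close>
  let ?S = "{Q. P \<subseteq> Q \<and> Q \<subseteq> nsets A 2 \<and> triangle_free Q}"
  have "finite ?S"
    by (rule finite_subset[of _ "Pow (nsets A 2)"]) (auto simp: finite_imp_finite_nsets assms(1))
  then obtain Q where Q: "Q \<in> ?S" and max: "\<And>R. R \<in> ?S \<Longrightarrow> Q \<subseteq> R \<Longrightarrow> R = Q"
    using finite_has_maximal2[of ?S P] assms(2,3) by (smt (verit) mem_Collect_eq order_refl)
  have "A \<subseteq> \<Union>Q"
  proof
    fix v assume v: "v \<in> A"
    show "v \<in> \<Union>Q"
    proof (rule ccontr)
      assume nv: "v \<notin> \<Union>Q"
      have "A \<noteq> {v}" using assms(4) by auto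
      then obtain w where w: "w \<in> A" "w \<noteq> v" using v by blast
      have sub: "Q \<subseteq> nsets A 2" and tf: "triangle_free Q" using Q by auto
      let ?R = "insert {v, w} Q"
      \<comment> \<open>A triangle of \<open>?R\<close> through \<open>v\<close> would have both
        other corners equal to \<open>w\<close>, the only neighbour of \<open>v\<close>, and hence a
        loop at \<open>w\<close>.\<close>
      have "{x} \<notin> Q" for x using sub by (auto simp: nsets_def)
      then have no_loop: "{x} \<notin> ?R" for x using w by auto
      have leaf: "x = w" if "{v, x} \<in> ?R" for x using that nv by (auto simp: doubleton_eq_iff)
      have old: "{x, y} \<in> Q" if "{x, y} \<in> ?R" "x \<noteq> v" "y \<noteq> v" for x y using that by blast
      have "triangle_free ?R"
        unfolding triangle_free_def
      proof (intro allI impI notI)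
        fix a b c assume R: "{a, b} \<in> ?R" "{a, c} \<in> ?R" "{b, c} \<in> ?R"
        consider "a = v" | "b = v" | "c = v" | "a \<noteq> v" "b \<noteq> v" "c \<noteq> v" by blast
        then show False
        proof cases
          case 1
          then have "b = w" "c = w" using R leaf by blast+
          then show False using R(3) no_loop[of w] by (metis insert_absorb2)
        next
          case 2
          then have "a = w" "c = w" using R leaf by (metis insert_commute)+
          then show False using R(2) no_loop[of w] by (metis insert_absorb2)
        next
          case 3
          then have "a = w" "b = w" using R leaf by (metis insert_commute)+
          then show False using R(1) no_loop[of w] by (metis insert_absorb2)
        next
          case 4
          then show False using R old tf unfolding triangle_free_def by meson
        qed
      qed
      then have "insert {v, w} Q \<in> ?S" using Q v w by (auto intro: nsets_2_memI)
      then have "insert {v, w} Q = Q" using max by blast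
      then show False using nv by blast
    qed
  qed
  moreover have "\<Union>Q \<subseteq> A" using Q by (auto simp: nsets_def)
  ultimately show thesis using that[of Q] mantel[of A Q] Q assms(1) by blast
qed

subsection \<open>Families of \<open>k\<close>-subsets of a set with \<open>k + 2\<close> elements\<close>

text \<open>In complements one has to cover all pairs by 4-sets. Splitting the ground set into
  blocks of size at most two, the unions of two blocks do this.\<close>

lemma cover_of_all_nsets:
  fixes U :: "'a set"
  assumes "finite U" "card U = k + 2" "k \<ge> 3"
  obtains C where "C \<subseteq> nsets U (k - 2)" "\<And>f. f \<in> nsets U k \<Longrightarrow> \<exists>c\<in>C. c \<subseteq> f"
    "card C \<le> (k ^ 2 + 3) div 4"
proof -
  obtain h where h: "bij_betw h U {0..<k + 2}"
    using ex_bij_betw_finite_nat[OF assms(1)] assms(2) by auto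
  \<comment> \<open>The \<open>k + 2\<close> indices fall into \<open>m\<close> blocks
    \<open>{2 * i, 2 * i + 1}\<close>, the last of them a single point if \<open>k\<close> is
    odd.\<close>
  define m where "m = (k + 3) div 2"
  define pre where "pre = (\<lambda>S. {a \<in> U. h a div 2 \<in> S})"
  have m3: "m \<ge> 3" using assms(3) by (simp add: m_def)
  \<comment> \<open>Two blocks have at most four points, so their complement contains a set of size
    \<open>k - 2\<close>.\<close>
  have "\<exists>c. c \<subseteq> U - pre S \<and> card c = k - 2" if S: "S \<in> nsets {..<m} 2" for S
  proof -
    obtain i j where ij: "S = {i, j}" using S by (elim nsets_2_memE)
    have "card (pre S) = card (h ` pre S)"
    proof (rule card_image[symmetric])
      show "inj_on h (pre S)"
        using bij_betw_imp_inj_on[OF h] by (rule inj_on_subset) (simp add: pre_def subset_iff)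
    qed
    also have "\<dots> \<le> card {2 * i, 2 * i + 1, 2 * j, 2 * j + 1}"
    proof (rule card_mono)
      have "i = 2 * (i div 2) \<or> i = 2 * (i div 2) + 1" for i :: nat by presburger
      then show "h ` pre S \<subseteq> {2 * i, 2 * i + 1, 2 * j, 2 * j + 1}"
        unfolding pre_def ij by blast
    qed simp
    also have "\<dots> \<le> 4" by (simp add: card_insert_if)
    finally have "k - 2 \<le> card (U - pre S)"
      using assms by (subst card_Diff_subset) (auto simp: pre_def)
    then show ?thesis by (metis obtain_subset_with_card_n)
  qed
  then obtain c where c: "\<And>S. S \<in> nsets {..<m} 2 \<Longrightarrow> c S \<subseteq> U - pre S \<and> card (c S) = k - 2"
    by metis
  show thesis
  proof (rule that[of "c ` nsets {..<m} 2"])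
    show "c ` nsets {..<m} 2 \<subseteq> nsets U (k - 2)"
    proof
      fix d assume "d \<in> c ` nsets {..<m} 2"
      then have "d \<subseteq> U" "card d = k - 2" using c by blast+
      then show "d \<in> nsets U (k - 2)" using finite_subset[OF _ assms(1)] by (simp add: nsets_def)
    qed
    have "card (c ` nsets {..<m} 2) \<le> m choose 2"
      using card_image_le[of "nsets {..<m} 2" c] by (simp add: card_nsets finite_imp_finite_nsets)
    also have "\<dots> = m * (m - 1) div 2" by (rule choose_two)
    also have "\<dots> \<le> (k ^ 2 + 3) div 4"
    proof (cases "odd k")
      case True
      then obtain j where j: "k = 2 * j + 1" by (elim oddE)
      have "m = j + 2" by (simp add: m_def j)
      moreover have "(k ^ 2 + 3) div 4 = j * j + j + 1"
      proof -
        have "k ^ 2 + 3 = 4 * (j * j + j + 1)" by (simp add: j power2_eq_square)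
        then show ?thesis by simp
      qed
      moreover have "j \<le> j * j" by simp
      then have "(j + 2) * (j + 2 - 1) \<le> 2 * (j * j + j + 1)" by simp
      then have "(j + 2) * (j + 2 - 1) div 2 \<le> j * j + j + 1"
        by (metis div_le_mono nonzero_mult_div_cancel_left zero_neq_numeral)
      ultimately show ?thesis by simp
    next
      case False
      then obtain j where j: "k = 2 * j" by (auto elim: evenE)
      have "m = j + 1" by (simp add: m_def j)
      moreover have "(k ^ 2 + 3) div 4 = j * j" by (simp add: j power2_eq_square)
      moreover have "j \<le> j * j" by simp
      then have "(j + 1) * (j + 1 - 1) \<le> 2 * (j * j)" by simp
      then have "(j + 1) * (j + 1 - 1) div 2 \<le> j * j"
        by (metis div_le_mono nonzero_mult_div_cancel_left zero_neq_numeral)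
      ultimately show ?thesis by simp
    qed
    finally show "card (c ` nsets {..<m} 2) \<le> (k ^ 2 + 3) div 4" .
    fix f assume f: "f \<in> nsets U k"
    then have "finite f" "f \<subseteq> U" "card f = k" by (auto simp: nsets_def)
    then have "card (U - f) = 2" using assms by (simp add: card_Diff_subset)
    then obtain a b where ab: "U - f = {a, b}" by (auto simp: card_2_iff)
    have hm: "h x div 2 < m" if "x \<in> U" for x
      using bij_betwE[OF h] that by (fastforce simp: m_def)
    obtain S where S: "S \<in> nsets {..<m} 2" "h a div 2 \<in> S" "h b div 2 \<in> S"
    proof -
      have *: "h a div 2 < m" "h b div 2 < m" using hm ab by auto
      show thesis
      proof (cases "h a div 2 = h b div 2")
        case True
        \<comment> \<open>If both points outside \<open>f\<close> lie in one block, any other block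
          completes \<open>S\<close> to a pair.\<close>
        define i :: nat where "i = (if h a div 2 = 0 then 1 else 0)"
        have "i < m" "i \<noteq> h a div 2" using m3 by (auto simp: i_def)
        then have "{i, h a div 2} \<in> nsets {..<m} 2" using *(1) by (intro nsets_2_memI) simp_all
        then show thesis using that True by (metis insertCI)
      next
        case False
        then have "{h a div 2, h b div 2} \<in> nsets {..<m} 2" using * by (intro nsets_2_memI) simp_all
        then show thesis using that by blast
      qed
    qed
    have "a \<in> pre S" "b \<in> pre S" using S ab by (auto simp: pre_def)
    then have "c S \<subseteq> U" "c S \<inter> (U - f) = {}" unfolding ab using c[OF S(1)] by blast+
    then have "c S \<subseteq> f" by blast
    then show "\<exists>c\<in>c ` nsets {..<m} 2. c \<subseteq> f" using S(1) by blast
  qed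
qed

subsection \<open>The family seen from a fixed edge\<close>

text \<open>\<open>inter\<close> is what matching number 1 gives: two edges meeting in fewer
  vertices would form a matching of size 2. For \<open>f = g\<close> it follows from
  uniformity.\<close>

locale based_family =
  fixes k :: nat and V :: "'a set" and E :: "'a set set" and e :: "'a set"
  assumes k3: "k \<ge> 3"
    and finV: "finite V"
    and E_sub: "E \<subseteq> nsets V k"
    and inter: "f \<in> E \<Longrightarrow> g \<in> E \<Longrightarrow> k - 2 \<le> card (f \<inter> g)"
    and eE: "e \<in> E"
begin

lemma edgeD: assumes "f \<in> E" shows "finite f" "f \<subseteq> V" "card f = k"
  using assms E_sub by (auto simp: nsets_def)

lemmas baseD = edgeD[OF eE]

lemma card_diff_swap: "f \<in> E \<Longrightarrow> card (f - e) = card (e - f)"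
  using edgeD baseD by (metis card_Diff_subset_Int finite_Int inf_commute)

lemma card_missing_le: assumes "f \<in> E" shows "card (e - f) \<le> 2"
  using inter[OF eE assms] baseD by (simp add: card_Diff_subset_Int)

definition "missing = {p. card p = 2 \<and> (\<exists>f\<in>E. p = e - f)}"

lemma missing_sub: "missing \<subseteq> nsets e 2"
  using baseD by (auto simp: missing_def nsets_def)

text \<open>For \<open>p \<subseteq> e\<close>, \<open>e - p\<close> lies in \<open>f\<close>
  exactly when \<open>e - f \<subseteq> p\<close>. If \<open>f\<close> misses two vertices of
  \<open>e\<close>, then \<open>e - f\<close> itself is in \<open>P\<close>; if it misses one,
  \<open>\<Union>P = e\<close> supplies a pair through that vertex; if none, any member of
  \<open>P\<close> works.\<close>

lemma cover_from_pairs: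
  assumes P: "P \<subseteq> nsets e 2" "missing \<subseteq> P" "\<Union>P = e" "card P \<le> n"
  shows "\<exists>C. m_cover (k - 2) V E C \<and> card C \<le> n"
proof (intro exI conjI)
  have finP: "finite P" using P(1) baseD finite_imp_finite_nsets finite_subset by metis
  show "card ((\<lambda>p. e - p) ` P) \<le> n" using card_image_le[OF finP] P(4) order_trans by blast
  show "m_cover (k - 2) V E ((\<lambda>p. e - p) ` P)"
    unfolding m_cover_def
  proof (intro conjI ballI subsetI)
    fix c assume "c \<in> (\<lambda>p. e - p) ` P"
    then obtain p where "c = e - p" "p \<in> nsets e 2" using P(1) by blast
    moreover from this have "p \<subseteq> e" "finite p" "card p = 2" by (simp_all add: nsets_def)
    ultimately have "c \<subseteq> V" "finite c" "card c = k - 2"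
      using baseD card_Diff_subset[of p e] by auto
    then show "c \<in> nsets V (k - 2)" by (simp add: nsets_def)
  next
    fix f assume f: "f \<in> E"
    have "\<exists>p\<in>P. e - f \<subseteq> p"
    proof -
      consider "card (e - f) = 0" | "card (e - f) = 1" | "card (e - f) = 2"
        using card_missing_le[OF f] by linarith
      then show ?thesis
      proof cases
        case 1
        have "P \<noteq> {}" using P(3) baseD k3 by force
        moreover have "e - f = {}" using 1 baseD(1) by simp
        ultimately show ?thesis by auto
      next
        case 2
        then obtain a where a: "e - f = {a}" by (metis card_1_singletonE)
        then have "a \<in> \<Union>P" using P(3) by blast
        then show ?thesis unfolding a by blast
      next
        case 3
        then have "e - f \<in> missing" using f by (auto simp: missing_def)
        then show ?thesis using P(2) by blast
      qed
    qed
    then obtain p where p: "p \<in> P" "e - f \<subseteq> p" by blast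
    then have "e - p \<subseteq> f" by blast
    with p(1) show "\<exists>c\<in>(\<lambda>p. e - p) ` P. c \<subseteq> f" by (rule bexI[OF _ imageI, rotated])
  qed
qed

text \<open>Inside \<open>e\<close> the two edges share only \<open>k - 4\<close> vertices, so they
  share at least two outside, where each of them has exactly two.\<close>

lemma disjoint_missing_same_rest:
  assumes f: "f \<in> E" "card (e - f) = 2" and g: "g \<in> E" "card (e - g) = 2"
    and disj: "(e - f) \<inter> (e - g) = {}"
  shows "f - e = g - e"
proof -
  let ?X = "(f - e) \<inter> (g - e)"
  have fin: "finite e" "finite f" "finite g" using edgeD f g eE by auto
  have un: "card ((e - f) \<union> (e - g)) = 4"
    using card_Un_disjoint[of "e - f" "e - g"] fin disj f(2) g(2) by simp
  have "card (e - ((e - f) \<union> (e - g))) = k - 4"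
    using card_Diff_subset[of "(e - f) \<union> (e - g)" e] fin un baseD(3) by (simp add: Un_subset_iff)
  \<comment> \<open>Subtraction is truncated: \<open>k - 2 = (k - 4) + 2\<close> requires
    this.\<close>
  moreover have "4 \<le> k"
    using card_mono[of e "(e - f) \<union> (e - g)"] fin un baseD(3) by (simp add: Un_subset_iff)
  moreover have "f \<inter> g = (e - ((e - f) \<union> (e - g))) \<union> ?X" by blast
  then have "card (f \<inter> g) \<le> card (e - ((e - f) \<union> (e - g))) + card ?X" by (metis card_Un_le)
  ultimately have "2 \<le> card ?X" using inter[OF f(1) g(1)] by linarith
  moreover have "card (f - e) = 2" "card (g - e) = 2"
    using card_diff_swap[OF f(1)] card_diff_swap[OF g(1)] f(2) g(2) by simp_all
  ultimately have "?X = f - e" "?X = g - e" using fin by (metis card_seteq finite_Diff inf_le1 inf_le2)+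
  then show ?thesis by simp
qed

text \<open>All edges lie in \<open>e \<union> X\<close>. The delicate ones miss a single vertex
  \<open>a\<close>: \<open>no_center\<close> provides an edge \<open>g\<close> that misses two
  others, and if the outside vertex of \<open>f\<close> were not in \<open>X\<close>, then
  \<open>f\<close> and \<open>g\<close> would share at most \<open>k - 3\<close> vertices.\<close>

lemma cover_if_common_rest:
  assumes X: "\<And>f. f \<in> E \<Longrightarrow> card (e - f) = 2 \<Longrightarrow> f - e = X"
    and no_center: "\<And>a. \<exists>p\<in>missing. a \<notin> p"
  shows "\<exists>C. m_cover (k - 2) V E C \<and> card C \<le> (k ^ 2 + 3) div 4"
proof -
  obtain f0 where f0: "f0 \<in> E" "card (e - f0) = 2"
    using no_center by (fastforce simp: missing_def)
  have X0: "X = f0 - e" using X[OF f0] by simp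
  have cX: "card X = 2" "finite X" "X \<inter> e = {}" "X \<subseteq> V"
    using card_diff_swap[OF f0(1)] f0 edgeD[OF f0(1)] by (auto simp: X0)
  have cU: "card (e \<union> X) = k + 2" "finite (e \<union> X)"
    using cX baseD by (auto simp: card_Un_disjoint inf_commute)
  have sub: "f \<subseteq> e \<union> X" if f: "f \<in> E" for f
  proof -
    consider "card (e - f) = 0" | "card (e - f) = 1" | "card (e - f) = 2"
      using card_missing_le[OF f] by linarith
    then show ?thesis
    proof cases
      case 1
      then show ?thesis using card_diff_swap[OF f] edgeD[OF f] by auto
    next
      case 2
      then obtain a where a: "e - f = {a}" by (metis card_1_singletonE)
      obtain z where z: "f - e = {z}" using 2 card_diff_swap[OF f] by (metis card_1_singletonE)
      obtain g where g: "g \<in> E" "card (e - g) = 2" "a \<notin> e - g"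
        using no_center[of a] by (auto simp: missing_def)
      have gX: "g - e = X" using X g by blast
      show ?thesis
      proof (rule ccontr)
        assume "\<not> f \<subseteq> e \<union> X"
        then have "z \<notin> X" using z by (simp flip: Diff_subset_conv)
        then have "(f - e) \<inter> (g - e) = {}" using z gX by simp
        moreover have "a \<notin> f" using a by blast
        ultimately have "f \<inter> g \<subseteq> e - insert a (e - g)" by blast
        then have "card (f \<inter> g) \<le> card (e - insert a (e - g))"
          using baseD by (intro card_mono) auto
        also have "\<dots> = k - card (insert a (e - g))"
          using baseD a by (subst card_Diff_subset) auto
        also have "\<dots> = k - 3" using g baseD by simp
        finally show False using inter[OF f g(1)] k3 by linarith
      qed
    next
      case 3
      then show ?thesis using X[OF f] by blast
    qed
  qed
  obtain C where C: "C \<subseteq> nsets (e \<union> X) (k - 2)" "\<And>f. f \<in> nsets (e \<union> X) k \<Longrightarrow> \<exists>c\<in>C. c \<subseteq> f"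
    "card C \<le> (k ^ 2 + 3) div 4"
    using cover_of_all_nsets[OF cU(2,1) k3] by blast
  have "nsets (e \<union> X) (k - 2) \<subseteq> nsets V (k - 2)" using cX baseD by (intro nsets_mono) auto
  moreover have "\<exists>c\<in>C. c \<subseteq> f" if "f \<in> E" for f
    using C(2)[of f] sub[OF that] edgeD[OF that] by (auto simp: nsets_def)
  ultimately have "m_cover (k - 2) V E C" using C(1) by (auto simp: m_cover_def)
  then show ?thesis using C(3) by blast
qed

section \<open>Covers according to the shape of the graph \<open>missing\<close>\<close>

lemma cover_if_triangle_free:
  assumes "triangle_free missing"
  shows "\<exists>C. m_cover (k - 2) V E C \<and> card C \<le> (k ^ 2 + 3) div 4"
proof -
  obtain Q where Q: "missing \<subseteq> Q" "Q \<subseteq> nsets e 2" "\<Union>Q = e" "4 * card Q \<le> k ^ 2"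
    using triangle_free_extend_covering[OF _ missing_sub assms] baseD k3 by auto
  then show ?thesis by (intro cover_from_pairs[of Q]) auto
qed

text \<open>All pairs meeting \<open>{u, v}\<close> are used, at most \<open>2 * k - 3\<close> of
  them. This equals the bound for \<open>k = 5\<close> and would exceed it for
  \<open>k = 4\<close>.\<close>

lemma cover_if_vertex_cover_2:
  assumes k5: "k \<ge> 5" and uv: "u \<in> e" "v \<in> e" "u \<noteq> v"
    and vc: "\<And>p. p \<in> missing \<Longrightarrow> u \<in> p \<or> v \<in> p"
  shows "\<exists>C. m_cover (k - 2) V E C \<and> card C \<le> (k ^ 2 + 3) div 4"
proof (rule cover_from_pairs)
  \<comment> \<open>\<open>?B\<close> leaves out \<open>u\<close>, so that \<open>{u, v}\<close> is
    counted once.\<close>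
  let ?A = "(\<lambda>w. {u, w}) ` (e - {u})" and ?B = "(\<lambda>w. {v, w}) ` (e - {u, v})"
  show "?A \<union> ?B \<subseteq> nsets e 2" using uv by (auto intro!: nsets_2_memI)
  show "missing \<subseteq> ?A \<union> ?B"
  proof
    fix p assume p: "p \<in> missing"
    then obtain a b where "p = {a, b}" "a \<noteq> b" "a \<in> e" "b \<in> e"
      using missing_sub by (meson nsets_2_memE subsetD)
    then show "p \<in> ?A \<union> ?B" using vc[OF p] by (auto simp: insert_commute)
  qed
  show "\<Union>(?A \<union> ?B) = e" using uv by auto
  have "card ?A \<le> k - 1" using card_image_le[of "e - {u}" "\<lambda>w. {u, w}"] baseD uv by simp
  moreover have "card (e - {u, v}) = k - 2" using baseD uv by (simp add: card_Diff_subset)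
  then have "card ?B \<le> k - 2" using card_image_le[of "e - {u, v}" "\<lambda>w. {v, w}"] baseD by simp
  ultimately have "card (?A \<union> ?B) \<le> 2 * k - 3" using card_Un_le[of ?A ?B] k5 by linarith
  also have "\<dots> \<le> (k ^ 2 + 3) div 4"
  proof -
    obtain j where j: "k = 5 + j" using k5 le_Suc_ex by blast
    have "j \<le> j * j" by simp
    then have "4 * (7 + 2 * j) \<le> k ^ 2 + 3" unfolding j power2_eq_square by (simp add: algebra_simps)
    then show ?thesis using j by simp
  qed
  finally show "card (?A \<union> ?B) \<le> (k ^ 2 + 3) div 4" .
qed

text \<open>To the six pairs of \<open>K\<close> one pair is added for each of the other
  \<open>k - 4\<close> vertices, so that all of \<open>e\<close> is spanned. The total
  \<open>k + 2\<close> equals the bound for \<open>k = 5\<close>.\<close>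

lemma cover_if_missing_in_K4:
  assumes k5: "k \<ge> 5" and K: "K \<subseteq> e" "card K = 4" "missing \<subseteq> nsets K 2"
  shows "\<exists>C. m_cover (k - 2) V E C \<and> card C \<le> (k ^ 2 + 3) div 4"
proof -
  obtain u where u: "u \<in> K" using K by fastforce
  let ?B = "(\<lambda>w. {u, w}) ` (e - K)"
  have finK: "finite K" using K baseD finite_subset by blast
  have 1: "nsets K 2 \<union> ?B \<subseteq> nsets e 2"
    using u K nsets_mono[OF K(1)] by (auto intro!: nsets_2_memI)
  have 2: "missing \<subseteq> nsets K 2 \<union> ?B" using K by blast
  have "\<Union>(nsets K 2) = K" by (rule Union_nsets_2) (simp add: K)
  then have 3: "\<Union>(nsets K 2 \<union> ?B) = e" using u K(1) by auto
  have "card (nsets K 2) = 6" using K by (simp add: card_nsets choose_two)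
  moreover have "card ?B \<le> k - 4"
    using card_image_le[of "e - K" "\<lambda>w. {u, w}"] baseD K finK by (simp add: card_Diff_subset)
  ultimately have "card (nsets K 2 \<union> ?B) \<le> k + 2" using card_Un_le[of "nsets K 2" ?B] k5 by linarith
  also have "\<dots> \<le> (k ^ 2 + 3) div 4"
  proof -
    obtain j where j: "k = 5 + j" using k5 le_Suc_ex by blast
    have "4 * (7 + j) \<le> k ^ 2 + 3" unfolding j power2_eq_square by (simp add: algebra_simps)
    then show ?thesis using j by simp
  qed
  finally show ?thesis by (rule cover_from_pairs[OF 1 2 3])
qed

text \<open>Without a vertex cover of size 2, each side of the triangle is disjoint from some
  missing pair, which fixes its outside part. If the three outside parts agree, all missing pairs
  share them; otherwise every missing pair meets the triangle, and all of them lie on one set of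
  four vertices.\<close>

lemma cover_if_triangle:
  assumes k5: "k \<ge> 5" and tri: "{x, y} \<in> missing" "{x, z} \<in> missing" "{y, z} \<in> missing"
  shows "\<exists>C. m_cover (k - 2) V E C \<and> card C \<le> (k ^ 2 + 3) div 4"
proof (cases "\<exists>u v. u \<in> e \<and> v \<in> e \<and> u \<noteq> v \<and> (\<forall>p\<in>missing. u \<in> p \<or> v \<in> p)")
  case True
  then show ?thesis using cover_if_vertex_cover_2[OF k5] by blast
next
  case no_vc: False
  have dist: "x \<noteq> y" "x \<noteq> z" "y \<noteq> z" and xyz: "x \<in> e" "y \<in> e" "z \<in> e"
    using tri by (auto simp: missing_def card_2_iff)
  \<comment> \<open>\<open>R p X\<close>: every edge missing exactly \<open>p\<close> has outside part \<open>X\<close>; \<open>X\<close> need not exist if \<open>p\<close>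
    meets all other missing pairs.\<close>
  define R where "R = (\<lambda>p X. \<forall>f\<in>E. e - f = p \<longrightarrow> f - e = X)"
  have R_unique: "X = Y" if "p \<in> missing" "R p X" "R p Y" for p X Y
    using that unfolding R_def missing_def by blast
  have R_ex: "\<exists>X. R p X \<and> R q X" if pq: "p \<in> missing" "q \<in> missing" "p \<inter> q = {}" for p q
  proof -
    obtain f g where fg: "f \<in> E" "e - f = p" "g \<in> E" "e - g = q" and c: "card p = 2" "card q = 2"
      using pq(1,2) unfolding missing_def by blast
    have "h - e = g - e" if "h \<in> E" "e - h = p" for h
      using disjoint_missing_same_rest[OF that(1) _ fg(3)] unfolding that(2) fg(4) using c pq(3) by blast
    moreover from this have "h - e = g - e" if "h \<in> E" "e - h = q" for h
      using disjoint_missing_same_rest[OF fg(1) _ that(1)] fg(1) unfolding fg(2) that(2)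
      using c pq(3) fg(2) by blast
    ultimately show ?thesis unfolding R_def by blast
  qed
  have R_disj: "R q X" if pq: "p \<in> missing" "q \<in> missing" "p \<inter> q = {}" "R p X" for p q X
    using R_ex[OF pq(1-3)] R_unique[OF pq(1,4)] by blast
  have pick: "\<exists>p\<in>missing. u \<notin> p \<and> v \<notin> p" if "u \<in> e" "v \<in> e" "u \<noteq> v" for u v
    using no_vc that by blast
  have pick': "\<exists>p\<in>missing. p \<inter> {u, v} = {}" if "{u, v} \<in> missing" for u v
  proof -
    have "{u, v} \<subseteq> e" "card {u, v} = 2" using that missing_sub by (auto simp: nsets_def)
    then have "u \<in> e" "v \<in> e" "u \<noteq> v" by auto
    then obtain p where "p \<in> missing" "u \<notin> p" "v \<notin> p" using pick by metis
    then show ?thesis by (intro bexI[of _ p]) simp_all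
  qed
  obtain pa pb pc where p: "pa \<in> missing" "pb \<in> missing" "pc \<in> missing"
    and pd: "pa \<inter> {y, z} = {}" "pb \<inter> {x, z} = {}" "pc \<inter> {x, y} = {}"
    using pick' tri by metis
  obtain Xa Xb Xc where Xt: "R {y, z} Xa" "R {x, z} Xb" "R {x, y} Xc"
    using R_ex[OF tri(3) p(1)] R_ex[OF tri(2) p(2)] R_ex[OF tri(1) p(3)] pd by blast
  have Xp: "R pa Xa" "R pb Xb" "R pc Xc"
    using R_disj[OF tri(3) p(1)] R_disj[OF tri(2) p(2)] R_disj[OF tri(1) p(3)] pd Xt by blast+
  have eq3: "Xa = Xb \<and> Xb = Xc" if q: "q \<in> missing" "R q Xa" "R q Xb" "R q Xc" for q
    using R_unique[OF q(1)] q by blast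
  have outside: "Xa = Xb \<and> Xb = Xc" if "q \<in> missing" "x \<notin> q" "y \<notin> q" "z \<notin> q" for q
    using R_disj[OF tri(3) that(1)] R_disj[OF tri(2) that(1)] R_disj[OF tri(1) that(1)] Xt eq3[OF that(1)] that
    by blast
  have eq2: "X = Y" if "q \<in> missing" "q' \<in> missing" "q \<inter> q' = {}" "R q X" "R q' Y" for q q' X Y
    using R_disj[OF that(1,2,3,4)] R_unique[OF that(2)] that(5) by blast
  show ?thesis
  proof (cases "Xa = Xb \<and> Xb = Xc")
    case True
    have all: "R q Xa" if q: "q \<in> missing" for q
    proof -
      obtain a b where ab: "q = {a, b}" "a \<noteq> b" using q by (auto simp: missing_def card_2_iff)
      \<comment> \<open>With at most one corner in it, \<open>q\<close> avoids a side; with two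
        corners it is a side.\<close>
      have "q \<inter> {y, z} = {} \<or> q \<inter> {x, z} = {} \<or> q \<inter> {x, y} = {} \<or>
          q = {y, z} \<or> q = {x, z} \<or> q = {x, y}" using ab dist by auto
      then show ?thesis
        using R_disj[OF tri(3) q] R_disj[OF tri(2) q] R_disj[OF tri(1) q] Xt True
        by (metis inf_commute)
    qed
    show ?thesis
    proof (rule cover_if_common_rest[of Xa])
      show "f - e = Xa" if "f \<in> E" "card (e - f) = 2" for f
        using all[of "e - f"] that unfolding missing_def R_def by blast
      show "\<exists>p\<in>missing. a \<notin> p" for a
        using tri dist by (metis insert_iff singletonD)
    qed
  next
    case ne: False
    have two: "\<exists>d. q = {w, d} \<and> d \<noteq> w" if q: "q \<in> missing" "w \<in> q" for q w
    proof -
      obtain s t where "q = {s, t}" "s \<noteq> t" using q(1) by (auto simp: missing_def card_2_iff)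
      then show ?thesis using q(2) by (metis insert_commute insert_iff singletonD)
    qed
    have "x \<in> pa" "y \<in> pb" "z \<in> pc" using outside p pd ne by blast+
    then obtain a b c where abc: "pa = {x, a}" "pb = {y, b}" "pc = {z, c}"
      and abc': "a \<noteq> x" "b \<noteq> y" "c \<noteq> z"
      using two p by metis
    have abc_out: "a \<notin> {x, y, z}" "b \<notin> {x, y, z}" "c \<notin> {x, y, z}" using abc abc' pd by auto
    \<comment> \<open>Were \<open>a\<close>, \<open>b\<close>, \<open>c\<close> not all equal, at
      least two of these premises would hold, and two of the conclusions already identify
      \<open>Xa\<close>, \<open>Xb\<close> and \<open>Xc\<close>.\<close>
    have "a \<noteq> b \<Longrightarrow> Xa = Xb" "a \<noteq> c \<Longrightarrow> Xa = Xc" "b \<noteq> c \<Longrightarrow> Xb = Xc"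
      using eq2[OF p(1) p(2) _ Xp(1,2)] eq2[OF p(1) p(3) _ Xp(1,3)] eq2[OF p(2) p(3) _ Xp(2,3)]
        abc abc_out dist by auto
    then have same: "b = a" "c = a" using ne by metis+
    have "missing \<subseteq> nsets {x, y, z, a} 2"
    proof (rule subsetI, rule ccontr)
      fix q assume q: "q \<in> missing" "q \<notin> nsets {x, y, z, a} 2"
      have "card q = 2" using q(1) by (simp add: missing_def)
      moreover from this have "finite q" by (simp add: card_ge_0_finite)
      ultimately have "\<not> q \<subseteq> {x, y, z, a}" using q(2) by (simp add: nsets_def)
      then obtain w where w: "w \<in> q" "w \<notin> {x, y, z, a}" by blast
      then obtain v where v: "q = {w, v}" "v \<noteq> w" using two q by blast
      have "x \<in> q \<or> y \<in> q \<or> z \<in> q" using outside[OF q(1)] ne by blast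
      then have "v \<in> {x, y, z}" using v w by auto
      \<comment> \<open>Say \<open>v = x\<close>: then \<open>q\<close> is disjoint from the side
        \<open>{y, z}\<close> and from \<open>pb\<close> and \<open>pc\<close>, so it takes on all
        three outside parts.\<close>
      then have "{y, z} \<inter> q = {} \<or> pa \<inter> q = {}" "{x, z} \<inter> q = {} \<or> pb \<inter> q = {}"
        "{x, y} \<inter> q = {} \<or> pc \<inter> q = {}"
        unfolding abc same v(1) using abc_out(1) w(2) dist by auto
      then have "R q Xa" "R q Xb" "R q Xc"
        using R_disj[OF tri(3) q(1) _ Xt(1)] R_disj[OF tri(2) q(1) _ Xt(2)] R_disj[OF tri(1) q(1) _ Xt(3)]
          R_disj[OF p(1) q(1) _ Xp(1)] R_disj[OF p(2) q(1) _ Xp(2)] R_disj[OF p(3) q(1) _ Xp(3)]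
        by blast+
      then show False using eq3[OF q(1)] ne by blast
    qed
    moreover have "{x, y, z, a} \<subseteq> e" using xyz p(1) abc missing_sub by (auto simp: nsets_def)
    moreover have "card {x, y, z, a} = 4" using dist abc_out by auto
    ultimately show ?thesis using cover_if_missing_in_K4[OF k5] by blast
  qed
qed

section \<open>Uniformities 3 and 4\<close>

lemma cover_k3:
  assumes "k = 3"
  shows "\<exists>C. m_cover (k - 2) V E C \<and> card C \<le> (k ^ 2 + 3) div 4"
proof (rule cover_from_pairs)
  show "nsets e 2 \<subseteq> nsets e 2" "missing \<subseteq> nsets e 2" using missing_sub by auto
  show "\<Union>(nsets e 2) = e" by (rule Union_nsets_2) (use baseD k3 in simp)
  show "card (nsets e 2) \<le> (k ^ 2 + 3) div 4" using baseD assms by (simp add: card_nsets choose_two)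
qed

text \<open>\<open>X\<close> lies in every edge missing \<open>{a, b}\<close> or
  \<open>{c, d}\<close>, and \<open>Y\<close> in every edge missing \<open>{a, c}\<close> or
  \<open>{b, d}\<close>. An edge containing neither \<open>{a, d}\<close> nor \<open>{b, c}\<close>
  misses a vertex of each, so its missing pair is one of those four.\<close>

lemma cover_k4_two_matchings:
  assumes e: "e = {a, b, c, d}" "distinct [a, b, c, d]"
    and m1: "{a, b} \<in> missing" "{c, d} \<in> missing"
    and m2: "{a, c} \<in> missing" "{b, d} \<in> missing"
  shows "\<exists>C. m_cover 2 V E C \<and> card C \<le> 4"
proof -
  have rest: "\<exists>X\<in>nsets V 2. \<forall>f\<in>E. e - f = p \<or> e - f = q \<longrightarrow> X \<subseteq> f"
    if pq: "p \<in> missing" "q \<in> missing" "p \<inter> q = {}" for p q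
  proof -
    obtain f g where fg: "f \<in> E" "p = e - f" "card p = 2" "g \<in> E" "q = e - g" "card q = 2"
      using pq by (auto simp: missing_def)
    have "g - e = f - e" using disjoint_missing_same_rest[of f g] fg pq(3) by simp
    have "h - e = f - e" if h: "h \<in> E" "e - h = p \<or> e - h = q" for h
      using h(2)
    proof
      assume "e - h = p"
      then show ?thesis
        using disjoint_missing_same_rest[of h g] h(1) fg pq(3) \<open>g - e = f - e\<close> by simp
    next
      assume "e - h = q"
      then show ?thesis using disjoint_missing_same_rest[of f h] h(1) fg pq(3) by simp
    qed
    moreover have "f - e \<in> nsets V 2"
      using fg card_diff_swap edgeD[of f] by (auto simp: nsets_def)
    ultimately show ?thesis by (metis Diff_subset)
  qed
  obtain X where X: "X \<in> nsets V 2" "\<forall>f\<in>E. e - f = {a, b} \<or> e - f = {c, d} \<longrightarrow> X \<subseteq> f"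
    using rest[OF m1] e by auto
  obtain Y where Y: "Y \<in> nsets V 2" "\<forall>f\<in>E. e - f = {a, c} \<or> e - f = {b, d} \<longrightarrow> Y \<subseteq> f"
    using rest[OF m2] e by auto
  have "\<exists>s\<in>{X, Y, {a, d}, {b, c}}. s \<subseteq> f" if f: "f \<in> E" for f
  proof (cases "{a, d} \<subseteq> f \<or> {b, c} \<subseteq> f")
    case False
    then obtain u v where uv: "u \<in> {a, d}" "v \<in> {b, c}" "u \<notin> f" "v \<notin> f" by blast
    then have "{u, v} \<subseteq> e - f" "card {u, v} = 2" using e by auto
    then have ef: "e - f = {u, v}"
      using card_missing_le[OF f] baseD by (metis card_seteq finite_Diff)
    have "e - f = {a, b} \<or> e - f = {c, d} \<or> e - f = {a, c} \<or> e - f = {b, d}"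
      unfolding ef using uv(1,2) by auto
    then have "X \<subseteq> f \<or> Y \<subseteq> f" using X(2) Y(2) f by metis
    then show ?thesis by blast
  qed auto
  moreover have "{X, Y, {a, d}, {b, c}} \<subseteq> nsets V 2"
    using X(1) Y(1) e baseD by (auto intro: nsets_2_memI)
  ultimately have "m_cover 2 V E {X, Y, {a, d}, {b, c}}" by (simp add: m_cover_def)
  moreover have "card {X, Y, {a, d}, {b, c}} \<le> 4" by (simp add: card_insert_if)
  ultimately show ?thesis by blast
qed

text \<open>Each of the first two matchings contributes at most one missing pair. Both pairs of the
  third are added; they already span \<open>e\<close>, and the total is four.\<close>

lemma cover_k4_two_nonmatchings:
  assumes k4: "k = 4" and e: "e = {a, b, c, d}" "distinct [a, b, c, d]"
    and m1: "\<not> ({a, b} \<in> missing \<and> {c, d} \<in> missing)"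
    and m2: "\<not> ({a, c} \<in> missing \<and> {b, d} \<in> missing)"
  shows "\<exists>C. m_cover 2 V E C \<and> card C \<le> 4"
proof -
  obtain p where p: "p = {a, b} \<or> p = {c, d}" "{a, b} \<in> missing \<Longrightarrow> p = {a, b}"
    "{c, d} \<in> missing \<Longrightarrow> p = {c, d}" using m1 by metis
  obtain q where q: "q = {a, c} \<or> q = {b, d}" "{a, c} \<in> missing \<Longrightarrow> q = {a, c}"
    "{b, d} \<in> missing \<Longrightarrow> q = {b, d}" using m2 by metis
  have "\<exists>C. m_cover (k - 2) V E C \<and> card C \<le> 4"
  proof (rule cover_from_pairs)
    show "{p, q, {a, d}, {b, c}} \<subseteq> nsets e 2" using p(1) q(1) e by (auto intro!: nsets_2_memI)
    show "\<Union>{p, q, {a, d}, {b, c}} = e" using p(1) q(1) e by auto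
    show "card {p, q, {a, d}, {b, c}} \<le> 4" by (simp add: card_insert_if)
    show "missing \<subseteq> {p, q, {a, d}, {b, c}}"
    proof
      fix r assume r: "r \<in> missing"
      then obtain s t where "r = {s, t}" "s \<noteq> t" "s \<in> e" "t \<in> e"
        using missing_sub by (meson nsets_2_memE subsetD)
      then have "r = {a, b} \<or> r = {a, c} \<or> r = {a, d} \<or> r = {b, c} \<or> r = {b, d} \<or> r = {c, d}"
        unfolding e(1) by (auto simp: doubleton_eq_iff)
      then show "r \<in> {p, q, {a, d}, {b, c}}" by (elim disjE) (use p(2,3) q(2,3) r in simp_all)
    qed
  qed
  then show ?thesis using k4 by simp
qed

text \<open>Of the three perfect matchings of a 4-set, two lie in \<open>missing\<close> or two do
  not. The orderings \<open>e\<close>, \<open>e2\<close> and \<open>e3\<close> run through the three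
  choices of two matchings.\<close>

lemma cover_k4:
  assumes k4: "k = 4"
  shows "\<exists>C. m_cover (k - 2) V E C \<and> card C \<le> (k ^ 2 + 3) div 4"
proof -
  obtain xs where xs: "set xs = e" "distinct xs" using finite_distinct_list baseD by blast
  then have "length xs = 4" using baseD k4 distinct_card by metis
  then obtain a b c d where "xs = [a, b, c, d]" by (auto simp: numeral_eq_Suc length_Suc_conv)
  then have e: "e = {a, b, c, d}" "distinct [a, b, c, d]" using xs by auto
  have e2: "e = {a, b, d, c}" "distinct [a, b, d, c]" and e3: "e = {a, c, d, b}" "distinct [a, c, d, b]"
    using e by auto
  \<comment> \<open>Each pair is written in one order, which leaves a purely propositional case
    analysis.\<close>
  note comm = insert_commute[of d c "{}"] insert_commute[of d b "{}"] insert_commute[of c b "{}"]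
  have "\<exists>C. m_cover 2 V E C \<and> card C \<le> 4"
    using cover_k4_two_matchings[OF e] cover_k4_two_nonmatchings[OF k4 e]
      cover_k4_two_matchings[OF e2, unfolded comm] cover_k4_two_nonmatchings[OF k4 e2, unfolded comm]
      cover_k4_two_matchings[OF e3, unfolded comm] cover_k4_two_nonmatchings[OF k4 e3, unfolded comm]
    by argo
  then show ?thesis using k4 by simp
qed

theorem ex_small_cover: "\<exists>C. m_cover (k - 2) V E C \<and> card C \<le> (k ^ 2 + 3) div 4"
proof -
  consider "k = 3" | "k = 4" | "k \<ge> 5" using k3 by linarith
  then show ?thesis
  proof cases
    case 3
    then show ?thesis
      using cover_if_triangle_free cover_if_triangle by (auto simp: triangle_free_def)
  qed (use cover_k3 cover_k4 in blast)+
qed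

end

section \<open>From small covers to \<open>cover_number\<close> and \<open>g1\<close>\<close>

lemma cover_number_le:
  assumes "finite V" "m_cover m V E C"
  shows "cover_number m V E \<le> card C"
proof -
  have "finite {C. m_cover m V E C}"
    by (rule finite_subset[of _ "Pow (nsets V m)"])
      (auto simp: m_cover_def finite_imp_finite_nsets assms(1))
  then show ?thesis unfolding cover_number_def using assms(2) by (intro Min_le) auto
qed

lemma matching_card_le:
  assumes "finite E" "m_matching m E M"
  shows "card M \<le> matching_number m E"
proof -
  have "finite {M. m_matching m E M}"
    by (rule finite_subset[of _ "Pow E"]) (auto simp: m_matching_def assms(1))
  then show ?thesis unfolding matching_number_def using assms(2) by (intro Max_ge) auto
qed

lemma cover_number_bound:
  fixes V :: "'a set"
  assumes k3: "k \<ge> 3" and H: "uniform_hypergraph k V E" and nu: "matching_number (k - 2) E = 1"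
  shows "cover_number (k - 2) V E \<le> (k ^ 2 + 3) div 4"
proof (cases "E = {}")
  case True
  then have "m_cover (k - 2) V E {}" by (simp add: m_cover_def)
  then show ?thesis using cover_number_le H by (fastforce simp: uniform_hypergraph_def)
next
  case False
  then obtain e where e: "e \<in> E" by blast
  have H': "finite V" "E \<subseteq> nsets V k" using H by (auto simp: uniform_hypergraph_def)
  then have finE: "finite E" using finite_imp_finite_nsets finite_subset by metis
  have inter: "k - 2 \<le> card (f \<inter> g)" if fg: "f \<in> E" "g \<in> E" for f g
  proof (cases "f = g")
    case True
    then show ?thesis using fg H' by (auto simp: nsets_def)
  next
    case False
    show ?thesis
    proof (rule ccontr)
      assume "\<not> ?thesis"
      then have "m_matching (k - 2) E {f, g}" using fg by (auto simp: m_matching_def Int_commute)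
      then show False
        using matching_card_le[OF finE, of "k - 2" "{f, g}"] nu False by simp
    qed
  qed
  interpret based_family k V E e by unfold_locales (fact k3 H' e inter)+
  show ?thesis using ex_small_cover cover_number_le[OF finV] order_trans by blast
qed

theorem theorem4:
  fixes k :: nat
  assumes "k \<ge> 3"
  shows "g1 k (k - 2) \<le> ereal (of_int \<lceil>real k ^ 2 / 4\<rceil>)
    \<and> real_of_int \<lceil>real k ^ 2 / 4\<rceil>
        = (if odd k then 1 / 4 * (real k ^ 2 + 3) else 1 / 4 * real k ^ 2)
    \<and> (\<forall>(V :: 'a set) E.
          uniform_hypergraph k V E \<and> matching_number (k - 2) E = 1
            \<longrightarrow> int (cover_number (k - 2) V E) \<le> \<lceil>real k ^ 2 / 4\<rceil>)"
proof (intro conjI allI impI)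
  show "g1 k (k - 2) \<le> ereal (of_int \<lceil>real k ^ 2 / 4\<rceil>)"
    unfolding g1_def
  proof (rule Sup_least)
    fix r assume "r \<in> {ereal (real (cover_number (k - 2) V E) / real (matching_number (k - 2) E)) | V E.
      uniform_hypergraph k (V :: nat set) E \<and> matching_number (k - 2) E = 1}"
    then obtain V :: "nat set" and E where
      r: "r = ereal (real (cover_number (k - 2) V E) / real (matching_number (k - 2) E))"
      and H: "uniform_hypergraph k V E" "matching_number (k - 2) E = 1" by blast
    \<comment> \<open>The denominator is 1, so the ratio is the cover number itself.\<close>
    show "r \<le> ereal (of_int \<lceil>real k ^ 2 / 4\<rceil>)"
      unfolding r H(2) ceiling_quarter_square using cover_number_bound[OF assms H] by simp
  qed
next
  show "real_of_int \<lceil>real k ^ 2 / 4\<rceil>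
        = (if odd k then 1 / 4 * (real k ^ 2 + 3) else 1 / 4 * real k ^ 2)"
    by (rule ceiling_quarter_square_cases)
next
  fix V :: "'a set" and E
  assume "uniform_hypergraph k V E \<and> matching_number (k - 2) E = 1"
  then show "int (cover_number (k - 2) V E) \<le> \<lceil>real k ^ 2 / 4\<rceil>"
    unfolding ceiling_quarter_square using cover_number_bound[OF assms] by (metis of_nat_mono)
qed

end
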